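(* Suppose that $q, r, s, x, y, z$ are integers with $q$ prime, $3\leq r<s$ and $x\neq 1$, such that $$y^q=\frac{x^r-1}{x-1}\quad\text{and}\quad z^q=\frac{x^s-1}{x-1}.$$ Then $$|x| < 4\,\max\left\{1,\frac{s}{qr}\right\}\, q^{\,r-1+\frac{s-r}{q-1}}.$$
   Context: The condition $x\neq 1$ is only to make the displayed quotients defined. *)

theory Defs
  imports Complex_Main "HOL-Computational_Algebra.Primes"
begin

end

theory Submission
  imports Defs "HOL-Number_Theory.Cong" "HOL-Analysis.Generalised_Binomial_Theorem"
begin

text \<open>
  Runge's method. Put \<open>t = 1/x\<close>. If \<open>q m = a (r - 1) + b (s - 1)\<close>, then up to sign
  \<open>y\<^sup>a z\<^sup>b = x\<^sup>m F(t)\<close> with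
  \<open>F(t) = (1 - t) powr (-(a + b)/q) * (1 - t\<^sup>r) powr (a/q) * (1 - t\<^sup>s) powr (b/q)\<close>.
  The coefficients of the power series \<open>F\<close> are bounded by \<open>2\<close>, and those of index at most \<open>m\<close>
  have denominators dividing \<open>D = q ^ (m + v\<^sub>q(m!))\<close>. Hence, if \<open>|x| \<ge> 4 D\<close>, the difference of
  \<open>D y\<^sup>a z\<^sup>b\<close> and \<open>D\<close> times the polynomial part of \<open>x\<^sup>m F(1/x)\<close> is an integer of absolute value
  less than \<open>1\<close>, and a contradiction arises once it is nonzero. If \<open>q\<close> does not divide \<open>a + b\<close>,
  it is not even divisible by \<open>q\<close>, because only the coefficient of \<open>t\<^sup>m\<close> has the full
  denominator \<open>D\<close>.

  If \<open>q\<close> divides \<open>r - 1\<close>, take \<open>a = 1\<close>, \<open>b = 0\<close>. Otherwise take \<open>b = 1\<close> and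
  the unique possible \<open>a < q\<close>. The case \<open>a = q - 1\<close>, in which \<open>q\<close> divides \<open>s - r\<close>, is exceptional:
  the denominators are then much smaller, and the difference is nonzero because its leading
  coefficient is positive and not too small.
\<close>

section \<open>Exponents of denominators and valuations of factorials\<close>

text \<open>In \<open>(1 - t) powr (j / q)\<close> with integral \<open>j\<close>, the coefficient
  of index \<open>n\<close> is a product of \<open>n\<close> fractions over \<open>q\<close>,
  divided by \<open>fact n\<close>; the two summands count these powers of \<open>q\<close>.\<close>

definition bexp :: "nat \<Rightarrow> nat \<Rightarrow> nat"
  where "bexp q n = n + multiplicity q (fact n)"

text \<open>As \<open>fact i * fact j\<close> divides \<open>fact (i + j)\<close>, products of
  coefficients fit the denominator allowed at the total index.\<close>

lemma bexp_add_le: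
  assumes "prime q"
  shows "bexp q i + bexp q j \<le> bexp q (i + j)"
proof -
  have "multiplicity q (fact i * fact j) \<le> multiplicity q (fact (i + j) :: nat)"
    by (intro dvd_imp_multiplicity_le fact_fact_dvd_fact) auto
  moreover have "multiplicity q (fact i * fact j :: nat) = multiplicity q (fact i) + multiplicity q (fact j)"
    using assms by (intro prime_elem_multiplicity_mult_distrib) auto
  ultimately show ?thesis
    by (simp add: bexp_def)
qed

text \<open>The linear summand of \<open>bexp\<close> makes the growth strict; this frees a factor
  \<open>q\<close> at every smaller index.\<close>

lemma bexp_strict_mono:
  assumes "prime q" "i < j"
  shows "bexp q i < bexp q j"
proof -
  have "bexp q i + bexp q (j - i) \<le> bexp q j"
    using bexp_add_le[OF assms(1), of i "j - i"] assms(2) by simp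
  moreover have "j - i \<le> bexp q (j - i)"
    by (simp add: bexp_def)
  ultimately show ?thesis
    using assms(2) by linarith
qed

lemma bexp_mono:
  assumes "prime q" "i \<le> j"
  shows "bexp q i \<le> bexp q j"
  using bexp_strict_mono[OF assms(1), of i j] assms(2) by (cases "i = j") auto

lemma multiplicity_fact_Suc:
  assumes "prime (q::nat)"
  shows "multiplicity q (fact (Suc n) :: nat) = multiplicity q (Suc n) + multiplicity q (fact n)"
  unfolding fact_Suc using assms by (simp add: prime_elem_multiplicity_mult_distrib del: mult_Suc)

lemma multiplicity_fact_mult_add:
  assumes "prime (q::nat)" "i < q"
  shows "multiplicity q (fact (q * k + i) :: nat) = multiplicity q (fact (q * k))"
  using assms(2)
proof (induction i)
  case (Suc i)
  have "\<not> q dvd Suc (q * k + i)"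
    using Suc.prems by (metis add_Suc_right dvd_add_right_iff dvd_triv_left nat_dvd_not_less zero_less_Suc)
  then have "multiplicity q (Suc (q * k + i)) = 0"
    by (rule not_dvd_imp_multiplicity_0)
  then show ?case
    using Suc multiplicity_fact_Suc[OF assms(1), of "q * k + i"] by (simp del: fact_Suc)
qed simp

text \<open>Only the multiples of \<open>q\<close> in \<open>fact (q * k)\<close> contribute, and
  stripping one \<open>q\<close> from each leaves \<open>fact k\<close>.\<close>

lemma multiplicity_fact_mult:
  assumes "prime (q::nat)"
  shows "multiplicity q (fact (q * k) :: nat) = k + multiplicity q (fact k)"
proof (induction k)
  case (Suc k)
  have q: "q > 1"
    using assms by (rule prime_gt_1_nat)
  have "q * Suc k = Suc (q * k + (q - 1))"
    using q by simp
  then have "multiplicity q (fact (q * Suc k) :: nat)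
      = multiplicity q (q * Suc k) + multiplicity q (fact (q * k + (q - 1)))"
    using multiplicity_fact_Suc[OF assms, of "q * k + (q - 1)"] by (simp only:)
  also have "multiplicity q (q * Suc k) = Suc (multiplicity q (Suc k))"
    using q by (intro multiplicity_times_same) auto
  also have "multiplicity q (fact (q * k + (q - 1)) :: nat) = k + multiplicity q (fact k)"
    using multiplicity_fact_mult_add[OF assms, of "q - 1" k] Suc q by simp
  finally show ?case
    using multiplicity_fact_Suc[OF assms, of k] by simp
qed simp

text \<open>Legendre's bound: with \<open>k = n div q\<close> the recursion adds \<open>k\<close>,
  and \<open>(q - 1) * k + k = q * k \<le> n\<close>.\<close>

lemma multiplicity_fact_le:
  assumes "prime (q::nat)"
  shows "(q - 1) * multiplicity q (fact n :: nat) \<le> n"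
proof (induction n rule: less_induct)
  case (less n)
  have q: "q > 1"
    using assms by (rule prime_gt_1_nat)
  define k where "k = n div q"
  have n: "n = q * k + n mod q"
    by (simp add: k_def)
  show ?case
  proof (cases "n = 0")
    case False
    then have "k < n"
      using q by (simp add: k_def)
    have "multiplicity q (fact n :: nat) = k + multiplicity q (fact k)"
      using multiplicity_fact_mult_add[OF assms, of "n mod q" k] multiplicity_fact_mult[OF assms, of k] n q
      by simp
    then have "(q - 1) * multiplicity q (fact n :: nat) \<le> (q - 1) * k + k"
      using less[OF \<open>k < n\<close>] by (simp add: distrib_left)
    also have "\<dots> = q * k"
      using q by (cases q) auto
    finally show ?thesis
      using n by linarith
  qed simp
qed

lemma bexp_le:
  assumes "prime q"
  shows "real (bexp q n) \<le> real q * real n / (real q - 1)"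
proof -
  have q: "q > 1"
    using assms by (rule prime_gt_1_nat)
  have "real ((q - 1) * multiplicity q (fact n :: nat)) \<le> real n"
    using multiplicity_fact_le[OF assms] of_nat_le_iff by blast
  then have "(real q - 1) * real (multiplicity q (fact n :: nat)) \<le> real n"
    using q by (simp add: of_nat_diff)
  then show ?thesis
    using q by (simp add: bexp_def field_simps)
qed

section \<open>Binomial series of \<open>(1 - t) powr \<alpha>\<close>\<close>

definition bc :: "real \<Rightarrow> nat \<Rightarrow> real"
  where "bc \<alpha> n = (-1) ^ n * (\<alpha> gchoose n)"

lemma bc_0 [simp]: "bc \<alpha> 0 = 1"
  by (simp add: bc_def)

lemma bc_sums: 
  assumes "\<bar>t\<bar> < 1"
  shows "(\<lambda>n. bc \<alpha> n * t ^ n) sums (1 - t) powr \<alpha>"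
  using gen_binomial_real[of "-t" \<alpha>] assms
  by (simp add: bc_def power_minus[of t] mult_ac)

lemma bc_Suc: "bc \<alpha> (Suc n) = bc \<alpha> n * ((real n - \<alpha>) / (real n + 1))"
  by (simp add: bc_def gbinomial_prod_rev field_simps)

text \<open>Taking partial sums is multiplication by \<open>1 / (1 - t)\<close>, which lowers the
  exponent by one.\<close>

lemma sum_bc: "(\<Sum>k\<le>n. bc \<alpha> k) = bc (\<alpha> - 1) n"
  using gbinomial_sum_lower_neg[of \<alpha> n] by (simp add: bc_def mult.commute)

text \<open>Consecutive coefficients have ratio \<open>(n + \<alpha>) / (n + 1)\<close>, which lies
  between \<open>0\<close> and \<open>1\<close>.\<close>

lemma bc_neg_bounds:
  assumes "0 \<le> \<alpha>" "\<alpha> \<le> 1"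
  shows "0 \<le> bc (-\<alpha>) n \<and> bc (-\<alpha>) n \<le> 1"
proof (induction n)
  case (Suc n)
  have "0 \<le> (real n + \<alpha>) / (real n + 1)" "(real n + \<alpha>) / (real n + 1) \<le> 1"
    using assms by auto
  then show ?case
    using Suc unfolding bc_Suc[of "-\<alpha>"] diff_minus_eq_add by (intro conjI mult_nonneg_nonneg mult_le_one) auto
qed simp

text \<open>The ratios of consecutive coefficients dominate those of
  \<open>\<alpha> / (n + 1)\<close>. This lower bound settles nonvanishing in the exceptional
  case.\<close>

lemma bc_neg_ge:
  assumes "0 \<le> \<alpha>"
  shows "\<alpha> / (real n + 1) \<le> bc (-\<alpha>) (Suc n)"
proof (induction n)
  case 0
  then show ?case by (simp add: bc_Suc)
next
  case (Suc n)
  have "\<alpha> / (real (Suc n) + 1) = \<alpha> / (real n + 1) * ((real n + 1) / (real n + 2))"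
    by (auto simp: divide_simps)
  also have "\<dots> \<le> bc (-\<alpha>) (Suc n) * ((real (Suc n) + \<alpha>) / (real (Suc n) + 1))"
  proof (intro mult_mono Suc)
    show "(real n + 1) / (real n + 2) \<le> (real (Suc n) + \<alpha>) / (real (Suc n) + 1)"
      using assms by (intro frac_le) auto
    show "0 \<le> bc (-\<alpha>) (Suc n)"
      using order_trans[OF _ Suc] assms by simp
  qed (use assms in auto)
  also have "\<dots> = bc (-\<alpha>) (Suc (Suc n))"
    by (simp add: bc_Suc)
  finally show ?case .
qed

lemma bc_nonpos:
  assumes "0 \<le> \<beta>" "\<beta> \<le> 1" "n > 0"
  shows "bc \<beta> n \<le> 0"
proof -
  have "bc \<beta> (Suc k) \<le> 0" for k
  proof (induction k)
    case 0
    then show ?case using assms by (simp add: bc_Suc)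
  next
    case (Suc k)
    then show ?case
      using assms by (subst bc_Suc) (intro mult_nonpos_nonneg divide_nonneg_nonneg; simp)
  qed
  from this[of "n - 1"] show ?thesis using assms by simp
qed

text \<open>Write \<open>fact k = q ^ v * u\<close> with \<open>u\<close> prime to \<open>q\<close>.
  Modulo \<open>u\<close> the number \<open>q\<close> has an inverse \<open>w\<close>, which turns
  the numerator \<open>P\<close> into the product of the consecutive integers
  \<open>n * w - j\<close>; \<open>fact k\<close>, hence \<open>u\<close>, divides that. If
  \<open>q\<close> does not divide \<open>n\<close>, it divides no factor \<open>n - j * q\<close>
  of \<open>P\<close>.\<close>

lemma bc_integrality:
  fixes n :: int
  assumes "prime q"
  obtains z :: int where "real q ^ bexp q k * bc (of_int n / real q) k = of_int z"
    "\<not> int q dvd n \<Longrightarrow> \<not> int q dvd z"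
proof -
  have q: "q > 1"
    using assms by (rule prime_gt_1_nat)
  define v where "v = multiplicity q (fact k :: nat)"
  have "q ^ v dvd (fact k :: nat)"
    unfolding v_def by (rule multiplicity_dvd)
  then obtain u :: nat where u: "fact k = q ^ v * u"
    by (elim dvdE)
  have "\<not> q dvd u"
  proof
    assume "q dvd u"
    then have "q ^ Suc v dvd (fact k :: nat)"
      using u by (simp add: mult.commute)
    then have "Suc v \<le> v"
      unfolding v_def using q by (subst (asm) power_dvd_iff_le_multiplicity) auto
    then show False by simp
  qed
  then have cop: "coprime (int q) (int u)"
    using assms by (simp add: prime_imp_coprime)
  have u0: "u > 0"
    using u by (metis fact_nonzero gr0I mult_0_right)
  define P where "P = (\<Prod>j<k. n - int j * int q)"
  obtain w where w: "[int q * w = 1] (mod int u)"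
    using cong_solve_coprime_int[OF cop] by auto
  have "[P * w ^ k = (\<Prod>j<k. n * w - int j)] (mod int u)"
  proof -
    have "[(n - int j * int q) * w = n * w - int j] (mod int u)" for j
    proof -
      have "[n * w - int j * (int q * w) = n * w - int j * 1] (mod int u)"
        using w by (intro cong_diff cong_mult) auto
      then show ?thesis by (simp add: algebra_simps)
    qed
    then have "[(\<Prod>j<k. (n - int j * int q) * w) = (\<Prod>j<k. n * w - int j)] (mod int u)"
      by (intro cong_prod)
    then show ?thesis
      by (simp add: P_def prod.distrib)
  qed
  moreover have "int u dvd (\<Prod>j<k. n * w - int j)"
  proof -
    have "int u dvd int (fact k)"
      unfolding int_dvd_int_iff u by simp
    also have "int (fact k) dvd (\<Prod>j<k. n * w - int j)"
      unfolding atLeast0LessThan[symmetric] gbinomial_int_mult_fact[of k "n * w", symmetric] by simp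
    finally show ?thesis .
  qed
  ultimately have "int u dvd P * w ^ k"
    using cong_dvd_iff by blast
  moreover have "coprime (int u) (w ^ k)"
  proof -
    have "coprime (int q * w) (int u)"
      using cong_imp_coprime[OF cong_sym[OF w]] by simp
    then show ?thesis
      by (simp add: coprime_commute)
  qed
  ultimately have "int u dvd P"
    by (simp add: coprime_dvd_mult_left_iff)
  then obtain z where z: "P = int u * z"
    by (elim dvdE)
  show ?thesis
  proof
    have "bc (of_int n / real q) k * (real q ^ k * fact k) = (-1) ^ k * ((\<Prod>j<k. of_int n / real q - real j) * real q ^ k)"
      by (simp add: bc_def gbinomial_prod_rev atLeast0LessThan)
    also have "(\<Prod>j<k. of_int n / real q - real j) * real q ^ k = (\<Prod>j<k. (of_int n / real q - real j) * real q)"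
      by (simp add: prod.distrib)
    also have "\<dots> = of_int P"
      unfolding P_def of_int_prod using q by (intro prod.cong) (auto simp: field_simps)
    also have "of_int P = real u * of_int z"
      by (simp add: z)
    also have "(fact k :: real) = real q ^ v * real u"
      using u by (metis of_nat_fact of_nat_mult of_nat_power)
    finally have "real u * (real q ^ bexp q k * bc (of_int n / real q) k) = real u * of_int ((-1) ^ k * z)"
      by (simp add: bexp_def v_def power_add mult_ac)
    then show "real q ^ bexp q k * bc (of_int n / real q) k = of_int ((-1) ^ k * z)"
      using u0 by simp
  next
    assume n: "\<not> int q dvd n"
    have pq: "prime (int q)"
      using assms by simp
    have "\<not> int q dvd P"
    proof
      assume "int q dvd P"
      then obtain j where "int q dvd n - int j * int q"
        unfolding P_def using prime_dvd_prod_iff[OF _ pq, of "{..<k}"] by auto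
      then show False
        using n by (metis dvd_diff_right_iff dvd_triv_right dvd_diff_left_iff)
    qed
    then show "\<not> int q dvd (-1) ^ k * z"
      using z by (metis dvd_mult dvd_mult_unit_iff' is_unit_power_iff dvd_minus_iff dvd_refl)
  qed
qed

section \<open>Products of power series and bounds for their coefficients\<close>

definition cprod :: "(nat \<Rightarrow> real) \<Rightarrow> (nat \<Rightarrow> real) \<Rightarrow> nat \<Rightarrow> real"
  where "cprod a b n = (\<Sum>i\<le>n. a i * b (n - i))"

text \<open>Substitution of \<open>t ^ r\<close> for \<open>t\<close> in a power series.\<close>

definition sparse :: "nat \<Rightarrow> (nat \<Rightarrow> real) \<Rightarrow> nat \<Rightarrow> real"
  where "sparse r b n = (if r dvd n then b (n div r) else 0)"

lemma summable_norm_bounded_coeffs: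
  fixes a :: "nat \<Rightarrow> real"
  assumes "\<And>n. \<bar>a n\<bar> \<le> A" "\<bar>t\<bar> < 1"
  shows "summable (\<lambda>n. norm (a n * t ^ n))"
proof (rule summable_comparison_test')
  show "summable (\<lambda>n. A * \<bar>t\<bar> ^ n)"
    using assms(2) by (intro summable_mult summable_geometric) auto
  show "norm (norm (a n * t ^ n)) \<le> A * \<bar>t\<bar> ^ n" for n
    using assms(1)[of n] by (simp add: abs_mult power_abs mult_right_mono)
qed

lemma cprod_sums:
  assumes "\<And>n. \<bar>a n\<bar> \<le> A" "\<And>n. \<bar>b n\<bar> \<le> B" "\<bar>t\<bar> < 1"
    and "(\<lambda>n. a n * t ^ n) sums u" "(\<lambda>n. b n * t ^ n) sums v"
  shows "(\<lambda>n. cprod a b n * t ^ n) sums (u * v)"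
proof -
  have "(\<lambda>n. \<Sum>i\<le>n. (a i * t ^ i) * (b (n - i) * t ^ (n - i))) sums (u * v)"
    using Cauchy_product_sums[OF summable_norm_bounded_coeffs[of a A t] summable_norm_bounded_coeffs[of b B t]]
      assms by (simp add: sums_iff)
  moreover have "(\<Sum>i\<le>n. (a i * t ^ i) * (b (n - i) * t ^ (n - i))) = cprod a b n * t ^ n" for n
    unfolding cprod_def sum_distrib_right
    by (intro sum.cong) (auto simp: mult_ac simp flip: power_add)
  ultimately show ?thesis
    by simp
qed

lemma sparse_sums:
  assumes "r > 0" "(\<lambda>n. b n * (t ^ r) ^ n) sums v"
  shows "(\<lambda>n. sparse r b n * t ^ n) sums v"
proof -
  have "(\<lambda>n. sparse r b (r * n) * t ^ (r * n)) sums v"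
    using assms by (simp add: sparse_def power_mult)
  moreover have "strict_mono (\<lambda>n. r * n)"
    using assms(1) by (simp add: strict_mono_def)
  moreover have "sparse r b n * t ^ n = 0" if "n \<notin> range (\<lambda>n. r * n)" for n
    using that by (auto simp: sparse_def elim: dvdE)
  ultimately show ?thesis
    using sums_mono_reindex[of "\<lambda>n. r * n" "\<lambda>n. sparse r b n * t ^ n"] by blast
qed

lemma sparse_0 [simp]: "sparse r b 0 = b 0"
  by (simp add: sparse_def)

lemma sum_sparse:
  assumes "r > 0"
  shows "(\<Sum>k\<le>n. sparse r b k) = (\<Sum>j\<le>n div r. b j)"
proof -
  have "(\<Sum>j\<le>n div r. b j) = (\<Sum>k\<in>(\<lambda>j. r * j) ` {..n div r}. sparse r b k)"
    using assms by (subst sum.reindex) (auto simp: inj_on_def sparse_def)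
  also have "\<dots> = (\<Sum>k\<le>n. sparse r b k)"
  proof (rule sum.mono_neutral_left)
    show "(\<lambda>j. r * j) ` {..n div r} \<subseteq> {..n}"
      using assms by (auto simp: less_eq_div_iff_mult_less_eq mult.commute)
    show "\<forall>i\<in>{..n} - (\<lambda>j. r * j) ` {..n div r}. sparse r b i = 0"
    proof
      fix i assume i: "i \<in> {..n} - (\<lambda>j. r * j) ` {..n div r}"
      have False if "r dvd i"
      proof -
        have "i = r * (i div r)" "i div r \<le> n div r"
          using i that by (auto intro: div_le_mono)
        then show False
          using i by blast
      qed
      then show "sparse r b i = 0"
        by (auto simp: sparse_def)
    qed
  qed auto
  finally show ?thesis ..
qed

text \<open>Properties of \<open>(1 - t) powr \<beta>\<close> with
  \<open>0 \<le> \<beta> \<le> 1\<close> that survive \<open>sparse\<close>: beyond index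
  \<open>0\<close> the negated coefficients are weights of total at most \<open>1\<close>.\<close>

definition subunit :: "(nat \<Rightarrow> real) \<Rightarrow> bool"
  where "subunit b \<longleftrightarrow> b 0 = 1 \<and> (\<forall>n>0. b n \<le> 0) \<and> (\<forall>n. (\<Sum>k\<le>n. b k) \<ge> 0)"

text \<open>The partial sums are coefficients for the exponent \<open>\<beta> - 1\<close>, hence
  nonnegative.\<close>

lemma subunit_bc:
  assumes "0 \<le> \<beta>" "\<beta> \<le> 1"
  shows "subunit (bc \<beta>)"
  using bc_nonpos[OF assms] bc_neg_bounds[of "1 - \<beta>"] assms
  by (auto simp: subunit_def sum_bc)

lemma subunit_sparse:
  assumes "subunit b" "r > 0"
  shows "subunit (sparse r b)"
  using assms unfolding subunit_def
  by (auto simp: sum_sparse) (auto simp: sparse_def elim!: dvdE)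

lemma sum_split_first: "(\<Sum>k\<le>n. b k) = b 0 + (\<Sum>k=1..n. b k)" for b :: "nat \<Rightarrow> real"
  by (simp add: atMost_atLeast0 sum.atLeast_Suc_atMost)

lemma subunit_tail:
  assumes "subunit b"
  shows "(\<Sum>k=1..n. - b k) \<le> 1"
  using assms sum_split_first[of b n] unfolding subunit_def sum_negf by (smt (verit))

lemma subunit_abs_le:
  assumes "subunit b"
  shows "\<bar>b n\<bar> \<le> 1"
proof (cases "n = 0")
  case False
  have "- b n \<le> (\<Sum>k=1..n. - b k)"
    using False assms by (intro member_le_sum) (auto simp: subunit_def)
  with subunit_tail[OF assms, of n] False assms show ?thesis
    by (auto simp: subunit_def abs_le_iff intro: order_trans[of _ 0])
qed (use assms in \<open>simp add: subunit_def\<close>)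

lemma cprod_split:
  assumes "b 0 = 1"
  shows "cprod a b n = a n + (\<Sum>k=1..n. a (n - k) * b k)"
proof -
  have "cprod a b n = (\<Sum>k\<le>n. a (n - k) * b k)"
    unfolding cprod_def
    by (rule sum.reindex_bij_witness[of _ "\<lambda>k. n - k" "\<lambda>k. n - k"]) auto
  then show ?thesis
    using assms by (simp add: sum_split_first)
qed

text \<open>\<open>a n\<close> lies between \<open>0\<close> and \<open>1\<close>, the remaining sum
  between \<open>-1\<close> and \<open>0\<close>; the opposite signs keep the bound
  \<open>1\<close>.\<close>

lemma cprod_subunit_bound_nonneg:
  assumes "subunit b" "\<And>i. 0 \<le> a i \<and> a i \<le> 1"
  shows "\<bar>cprod a b n\<bar> \<le> 1"
proof -
  have b: "b k \<le> 0" if "k \<in> {1..n}" for k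
    using assms(1) that by (auto simp: subunit_def)
  have "(\<Sum>k=1..n. a (n - k) * b k) \<le> 0"
    using assms(2) b by (intro sum_nonpos mult_nonneg_nonpos) auto
  moreover have "(\<Sum>k=1..n. b k) \<le> (\<Sum>k=1..n. a (n - k) * b k)"
  proof (intro sum_mono)
    fix k assume k: "k \<in> {1..n}"
    have "1 * b k \<le> a (n - k) * b k"
      using assms(2)[of "n - k"] b[OF k] by (intro mult_right_mono_neg) auto
    then show "b k \<le> a (n - k) * b k" by simp
  qed
  moreover have "(\<Sum>k=1..n. b k) \<ge> -1"
    using subunit_tail[OF assms(1), of n] by (simp add: sum_negf)
  ultimately show ?thesis
    using assms(1) assms(2)[of n] by (subst cprod_split) (auto simp: subunit_def)
qed

text \<open>Without a sign for \<open>a\<close> the two parts may add up; this is where the bound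
  \<open>2\<close> arises.\<close>

lemma cprod_subunit_bound:
  assumes "subunit b" "\<And>i. \<bar>a i\<bar> \<le> 1"
  shows "\<bar>cprod a b n\<bar> \<le> 2"
proof -
  have "\<bar>\<Sum>k=1..n. a (n - k) * b k\<bar> \<le> (\<Sum>k=1..n. \<bar>a (n - k) * b k\<bar>)"
    by (rule sum_abs)
  also have "\<dots> \<le> (\<Sum>k=1..n. - b k)"
  proof (intro sum_mono)
    fix k assume "k \<in> {1..n}"
    then have "\<bar>b k\<bar> = - b k"
      using assms(1) by (auto simp: subunit_def)
    moreover have "\<bar>a (n - k)\<bar> * \<bar>b k\<bar> \<le> 1 * \<bar>b k\<bar>"
      by (intro mult_right_mono assms(2)) auto
    ultimately show "\<bar>a (n - k) * b k\<bar> \<le> - b k"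
      by (simp add: abs_mult)
  qed
  also have "\<dots> \<le> 1"
    by (rule subunit_tail[OF assms(1)])
  finally show ?thesis
    using assms(1) assms(2)[of n] by (subst cprod_split) (auto simp: subunit_def)
qed

lemma power_series_tail_bound:
  fixes c :: "nat \<Rightarrow> real"
  assumes "(\<lambda>n. c n * t ^ n) sums S" "\<And>n. \<bar>c n\<bar> \<le> B" "\<bar>t\<bar> < 1"
  shows "\<bar>S - (\<Sum>i<m. c i * t ^ i)\<bar> \<le> B * \<bar>t\<bar> ^ m / (1 - \<bar>t\<bar>)"
proof -
  have "(\<lambda>i. c (i + m) * t ^ (i + m)) sums (S - (\<Sum>i<m. c i * t ^ i))"
    using assms(1) by (rule sums_split_initial_segment)
  moreover have "(\<lambda>i. B * \<bar>t\<bar> ^ m * \<bar>t\<bar> ^ i) sums (B * \<bar>t\<bar> ^ m * (1 / (1 - \<bar>t\<bar>)))"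
    using assms(3) by (intro sums_mult geometric_sums) auto
  moreover have "norm (c (i + m) * t ^ (i + m)) \<le> B * \<bar>t\<bar> ^ m * \<bar>t\<bar> ^ i" for i
    using assms(2)[of "i + m"]
    by (simp add: abs_mult power_abs power_add mult.assoc mult.commute[of "\<bar>t\<bar> ^ i"] mult_right_mono)
  ultimately have "norm (S - (\<Sum>i<m. c i * t ^ i)) \<le> B * \<bar>t\<bar> ^ m * (1 / (1 - \<bar>t\<bar>))"
    using norm_suminf_le[of "\<lambda>i. c (i + m) * t ^ (i + m)" "\<lambda>i. B * \<bar>t\<bar> ^ m * \<bar>t\<bar> ^ i"]
    by (simp add: sums_iff)
  then show ?thesis
    by simp
qed

section \<open>Denominators of the coefficients of products\<close>

text \<open>The denominators that occur in \<open>(1 - t) powr (n / q)\<close>; \<open>qsmall\<close> asks for one factor \<open>q\<close>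
  less, as in \<open>(1 - t\<^sup>r) powr (n / q)\<close>, so that multiplying by such a series does not change the
  leading \<open>q\<close>-adic digits of the coefficients.\<close>

definition qadm :: "nat \<Rightarrow> (nat \<Rightarrow> real) \<Rightarrow> bool"
  where "qadm q a \<longleftrightarrow> (\<forall>n. real q ^ bexp q n * a n \<in> \<int>)"

definition qsmall :: "nat \<Rightarrow> (nat \<Rightarrow> real) \<Rightarrow> bool"
  where "qsmall q b \<longleftrightarrow> (\<forall>n>0. real q ^ bexp q n * b n / real q \<in> \<int>)"

lemma qadm_bc:
  assumes "prime q"
  shows "qadm q (bc (of_int n / real q))"
  unfolding qadm_def by (metis Ints_of_int bc_integrality[OF assms])

lemma qadm_shift:
  assumes "qadm q a" "bexp q n \<le> e"
  shows "real q ^ e * a n \<in> \<int>"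
proof -
  have "real q ^ e * a n = real q ^ (e - bexp q n) * (real q ^ bexp q n * a n)"
    using assms(2) by (simp flip: power_add mult.assoc)
  then show ?thesis
    using assms(1) unfolding qadm_def by (metis Ints_mult Ints_of_nat of_nat_power)
qed

lemma qadm_shift_less:
  assumes "prime q" "qadm q a" "bexp q n < e"
  shows "real q ^ e * a n / real q \<in> \<int>"
proof -
  have "q > 0"
    using assms(1) by (rule prime_gt_0_nat)
  then have "real q ^ e * a n / real q = real q ^ (e - 1) * a n"
    using assms(3) by (cases e) auto
  then show ?thesis
    using qadm_shift[OF assms(2), of n "e - 1"] assms(3) by simp
qed

text \<open>A nonzero entry at index \<open>n > 0\<close> comes from index \<open>n div r\<close>,
  where \<open>bexp\<close> is strictly smaller.\<close>

lemma qsmall_sparse: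
  assumes "prime q" "qadm q b" "r \<ge> 2"
  shows "qsmall q (sparse r b)"
  unfolding qsmall_def
proof (intro allI impI)
  fix n :: nat assume n: "n > 0"
  show "real q ^ bexp q n * sparse r b n / real q \<in> \<int>"
  proof (cases "r dvd n")
    case True
    have "n div r < n"
      using n assms(3) by simp
    then show ?thesis
      using True qadm_shift_less[OF assms(1,2) bexp_strict_mono[OF assms(1)]] by (simp add: sparse_def)
  qed (simp add: sparse_def)
qed

text \<open>Every term of the difference contains some \<open>b k\<close> with \<open>k > 0\<close>,
  which spares one \<open>q\<close>; superadditivity of \<open>bexp\<close> covers the rest.\<close>

lemma cprod_qsmall:
  assumes "prime q" "qadm q a" "b 0 = 1" "qsmall q b"
  shows "real q ^ bexp q n * (cprod a b n - a n) / real q \<in> \<int>"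
proof -
  have "real q ^ bexp q n * (a (n - k) * b k) / real q \<in> \<int>" if "k \<in> {1..n}" for k
  proof -
    have k: "k > 0" "k \<le> n"
      using that by auto
    define d where "d = bexp q n - (bexp q (n - k) + bexp q k)"
    have e: "bexp q n = d + bexp q (n - k) + bexp q k"
      using bexp_add_le[OF assms(1), of "n - k" k] k by (simp add: d_def)
    have "real q ^ bexp q n * (a (n - k) * b k) / real q
        = real q ^ d * (real q ^ bexp q (n - k) * a (n - k)) * (real q ^ bexp q k * b k / real q)"
      unfolding e by (simp add: power_add)
    moreover have "real q ^ d \<in> \<int>"
      by (metis Ints_of_nat of_nat_power)
    ultimately show ?thesis
      using assms(2,4) k unfolding qadm_def qsmall_def by (metis Ints_mult)
  qed
  then have "(\<Sum>k=1..n. real q ^ bexp q n * (a (n - k) * b k) / real q) \<in> \<int>"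
    by (rule Ints_sum)
  then show ?thesis
    unfolding cprod_split[of b a n, OF assms(3)] by (simp add: sum_distrib_left sum_divide_distrib)
qed

lemma qadm_cprod:
  assumes "prime q" "qadm q a" "b 0 = 1" "qsmall q b"
  shows "qadm q (cprod a b)"
  unfolding qadm_def
proof
  fix n
  have "real q \<noteq> 0"
    using assms(1) prime_gt_0_nat[of q] by simp
  then have "real q ^ bexp q n * cprod a b n
      = real q * (real q ^ bexp q n * (cprod a b n - a n) / real q) + real q ^ bexp q n * a n"
    by (simp add: field_simps)
  then show "real q ^ bexp q n * cprod a b n \<in> \<int>"
    using cprod_qsmall[OF assms, of n] assms(2) unfolding qadm_def
    by (metis Ints_add Ints_mult Ints_of_nat)
qed

section \<open>The power series of the auxiliary function\<close>

text \<open>The nonnegative series of exponent \<open>-\<alpha>\<close> comes first, so that the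
  factor in \<open>t ^ r\<close> keeps the bound \<open>1\<close> and only the one in
  \<open>t ^ s\<close> doubles it.\<close>

definition rcoeff :: "real \<Rightarrow> real \<Rightarrow> real \<Rightarrow> nat \<Rightarrow> nat \<Rightarrow> nat \<Rightarrow> real"
  where "rcoeff \<alpha> \<beta> \<gamma> r s = cprod (cprod (bc (-\<alpha>)) (sparse r (bc \<beta>))) (sparse s (bc \<gamma>))"

context
  fixes \<alpha> \<beta> \<gamma> :: real and r s :: nat
  assumes exps: "0 \<le> \<alpha>" "\<alpha> \<le> 1" "0 \<le> \<beta>" "\<beta> \<le> 1" "0 \<le> \<gamma>" "\<gamma> \<le> 1"
    and rs: "r > 0" "s > 0"
begin

lemma cprod_bc_abs_le: "\<bar>cprod (bc (-\<alpha>)) (sparse r (bc \<beta>)) n\<bar> \<le> 1"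
  using bc_neg_bounds[OF exps(1,2)] exps rs
  by (intro cprod_subunit_bound_nonneg subunit_sparse subunit_bc) auto

lemma rcoeff_abs_le: "\<bar>rcoeff \<alpha> \<beta> \<gamma> r s n\<bar> \<le> 2"
  unfolding rcoeff_def
  using cprod_bc_abs_le exps rs by (intro cprod_subunit_bound subunit_sparse subunit_bc) auto

lemma rcoeff_sums:
  assumes "\<bar>t\<bar> < 1"
  shows "(\<lambda>n. rcoeff \<alpha> \<beta> \<gamma> r s n * t ^ n) sums
    ((1 - t) powr (-\<alpha>) * (1 - t ^ r) powr \<beta> * (1 - t ^ s) powr \<gamma>)"
proof -
  have pow: "\<bar>t ^ k\<bar> < 1" if "k > 0" for k
    using assms that by (simp add: power_abs power_less_one_iff)
  have sub: "subunit (sparse r (bc \<beta>))" "subunit (sparse s (bc \<gamma>))"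
    using exps rs by (auto intro!: subunit_sparse subunit_bc)
  have "\<bar>bc (-\<alpha>) n\<bar> \<le> 1" for n
    using bc_neg_bounds[OF exps(1,2), of n] by simp
  then have "(\<lambda>n. cprod (bc (-\<alpha>)) (sparse r (bc \<beta>)) n * t ^ n) sums
      ((1 - t) powr (-\<alpha>) * (1 - t ^ r) powr \<beta>)"
    by (rule cprod_sums[OF _ subunit_abs_le[OF sub(1)] assms bc_sums[OF assms]
          sparse_sums[OF rs(1) bc_sums[OF pow[OF rs(1)]]]])
  then show ?thesis
    unfolding rcoeff_def
    by (rule cprod_sums[OF cprod_bc_abs_le subunit_abs_le[OF sub(2)] assms _
          sparse_sums[OF rs(2) bc_sums[OF pow[OF rs(2)]]]])
qed

end

section \<open>Runge's method\<close>

text \<open>Both sides agree up to sign for \<open>y ^ a * z ^ b\<close>: write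
  \<open>y ^ q = x ^ (r - 1) * (1 - t ^ r) / (1 - t)\<close>, likewise for \<open>z\<close>, and
  compare \<open>q\<close>-th powers of absolute values.\<close>

lemma power_product_eq:
  fixes x y z :: int and a b r s q m :: nat
  defines "t \<equiv> 1 / real_of_int x"
  assumes "q > 0" "\<bar>x\<bar> \<ge> 2" "r > 0" "s > 0"
    and y: "(of_int y :: real) ^ q = (of_int x ^ r - 1) / (of_int x - 1)"
    and z: "(of_int z :: real) ^ q = (of_int x ^ s - 1) / (of_int x - 1)"
    and m: "q * m = a * (r - 1) + b * (s - 1)"
  obtains w :: int where "of_int w = of_int x ^ m * ((1 - t) powr (- (real (a + b) / real q)) *
      (1 - t ^ r) powr (real a / real q) * (1 - t ^ s) powr (real b / real q))"
proof -
  define X where "X = real_of_int x"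
  define F where "F = (1 - t) powr (- (real (a + b) / real q)) *
      (1 - t ^ r) powr (real a / real q) * (1 - t ^ s) powr (real b / real q)"
  have X: "\<bar>X\<bar> \<ge> 2" "X \<noteq> 0" "X \<noteq> 1" and tX: "t = 1 / X"
    using assms(3) by (auto simp: X_def t_def)
  have t: "\<bar>t\<bar> < 1"
    unfolding tX using X(1) by (simp add: divide_less_eq)
  have pos: "1 - t ^ k > 0" if "k > 0" for k
    using t that power_less_one_iff[of "\<bar>t\<bar>" k] by (simp add: power_abs[symmetric] abs_less_iff)
  have pos1: "1 - t > 0"
    using t by auto
  have quot: "\<bar>u\<bar> ^ q = \<bar>X\<bar> ^ (k - 1) * (1 - t ^ k) / (1 - t)"
    if "k > 0" "u ^ q = (X ^ k - 1) / (X - 1)" for k and u :: real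
  proof -
    have "X ^ k - 1 = X ^ (k - 1) * X * (1 - t ^ k)"
      using that(1) X by (simp add: tX power_divide right_diff_distrib flip: power_Suc2)
    moreover have "X - 1 = X * (1 - t)"
      using X by (simp add: tX algebra_simps)
    ultimately have "u ^ q = X ^ (k - 1) * (1 - t ^ k) / (1 - t)"
      using that(2) X by simp
    then have "\<bar>u\<bar> ^ q = \<bar>X ^ (k - 1) * (1 - t ^ k) / (1 - t)\<bar>"
      by (metis power_abs)
    then show ?thesis
      using pos[OF that(1)] pos1 by (simp add: abs_mult power_abs)
  qed
  have pw: "(u powr (c / real q)) ^ q = u powr c" if "u > 0" for u c :: real
    using that assms(2) by (simp add: powr_powr flip: powr_realpow)
  have "(\<bar>of_int y\<bar> ^ a * \<bar>of_int z\<bar> ^ b) ^ q = (\<bar>of_int y\<bar> ^ q) ^ a * (\<bar>of_int z\<bar> ^ q :: real) ^ b"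
    by (simp add: power_mult_distrib mult.commute flip: power_mult)
  also have "\<dots> = (\<bar>X\<bar> ^ (r - 1) * (1 - t ^ r) / (1 - t)) ^ a * (\<bar>X\<bar> ^ (s - 1) * (1 - t ^ s) / (1 - t)) ^ b"
    using quot[OF assms(4) y[folded X_def]] quot[OF assms(5) z[folded X_def]] by simp
  also have "\<dots> = \<bar>X\<bar> ^ (q * m) * ((1 - t ^ r) ^ a * (1 - t ^ s) ^ b / (1 - t) ^ (a + b))"
    unfolding m by (simp add: power_mult_distrib power_divide power_add mult_ac flip: power_mult)
  also have "(1 - t ^ r) ^ a * (1 - t ^ s) ^ b / (1 - t) ^ (a + b) = F ^ q"
    using pw[OF pos1, of "- real (a + b)"] pw[OF pos[OF assms(4)], of a] pw[OF pos[OF assms(5)], of b]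
      pos1 pos[OF assms(4)] pos[OF assms(5)]
    unfolding F_def
    by (simp only: power_mult_distrib minus_divide_left powr_minus powr_realpow) (simp add: field_simps)
  also have "\<bar>X\<bar> ^ (q * m) * F ^ q = (\<bar>X\<bar> ^ m * F) ^ q"
    by (simp add: power_mult_distrib mult.commute flip: power_mult)
  finally have "\<bar>of_int y\<bar> ^ a * \<bar>of_int z\<bar> ^ b = \<bar>X\<bar> ^ m * F"
    by (rule power_eq_imp_eq_base) (use assms(2) in \<open>auto simp: F_def\<close>)
  then have "\<bar>of_int (y ^ a * z ^ b)\<bar> = \<bar>X ^ m * F\<bar>"
    by (simp add: abs_mult power_abs F_def)
  then have "of_int (y ^ a * z ^ b) = X ^ m * F \<or> of_int (- (y ^ a * z ^ b)) = X ^ m * F"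
    by (auto simp: abs_eq_iff)
  then show ?thesis
    using that unfolding F_def X_def by blast
qed

text \<open>\<open>D\<close> times the difference in \<open>nz\<close> is a nonzero integer, whereas
  the tail bounds it by \<open>2 * D / (\<bar>x\<bar> - 1)\<close>; and
  \<open>2 * D + 1 < 4 * D\<close>.\<close>

lemma runge_bound:
  fixes x w :: int and D m :: nat
  defines "t \<equiv> 1 / real_of_int x"
  assumes "\<bar>x\<bar> \<ge> 2" "D > 0"
    and S: "(\<lambda>n. c n * t ^ n) sums S"
    and c: "\<And>n. \<bar>c n\<bar> \<le> 2" "\<And>i. i \<le> m \<Longrightarrow> real D * c i \<in> \<int>"
    and w: "of_int w = of_int x ^ m * S"
    and nz: "of_int w \<noteq> (\<Sum>i\<le>m. c i * of_int x ^ (m - i))"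
  shows "\<bar>x\<bar> < 4 * int D"
proof -
  define X where "X = real_of_int x"
  have X: "\<bar>X\<bar> \<ge> 2" "X \<noteq> 0" and tX: "t = 1 / X"
    using assms(2) by (auto simp: X_def t_def)
  have t: "\<bar>t\<bar> < 1"
    unfolding tX using X(1) by (simp add: divide_less_eq)
  define P where "P = (\<Sum>i\<le>m. c i * X ^ (m - i))"
  have P: "P = X ^ m * (\<Sum>i<Suc m. c i * t ^ i)"
    unfolding P_def lessThan_Suc_atMost sum_distrib_left
    using X by (intro sum.cong) (auto simp: tX power_diff power_divide)
  have "real D * P \<in> \<int>"
    unfolding P_def sum_distrib_left mult.assoc[symmetric] X_def
    using c(2) by (intro Ints_sum Ints_mult[of _ "_ ^ _"] Ints_power) auto
  then have "real D * (of_int w - P) \<in> \<int>"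
    by (simp add: right_diff_distrib)
  moreover have "real D * (of_int w - P) \<noteq> 0"
    using nz assms(3) by (simp add: P_def X_def)
  ultimately have "1 \<le> \<bar>real D * (of_int w - P)\<bar>"
    by (rule Ints_nonzero_abs_ge1)
  also have "\<dots> = real D * (\<bar>X\<bar> ^ m * \<bar>S - (\<Sum>i<Suc m. c i * t ^ i)\<bar>)"
    unfolding w P X_def[symmetric] by (simp add: abs_mult power_abs flip: right_diff_distrib)
  also have "\<dots> \<le> real D * (\<bar>X\<bar> ^ m * (2 * \<bar>t\<bar> ^ Suc m / (1 - \<bar>t\<bar>)))"
    by (intro mult_left_mono power_series_tail_bound[OF S c(1) t]) auto
  also have "\<bar>X\<bar> ^ m * (2 * \<bar>t\<bar> ^ Suc m / (1 - \<bar>t\<bar>)) = 2 / (\<bar>X\<bar> - 1)"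
    using X by (simp add: tX power_divide field_simps)
  finally have "\<bar>X\<bar> - 1 \<le> 2 * real D"
    using X by (simp add: divide_simps)
  then have "\<bar>X\<bar> < 4 * real D"
    using assms(3) by linarith
  then show ?thesis
    unfolding X_def by linarith
qed

text \<open>As \<open>q\<close> does not divide \<open>a + b\<close>, vanishing is excluded
  \<open>q\<close>-adically: after multiplication by \<open>q ^ (bexp q m - 1)\<close> only the term
  of index \<open>m\<close> fails to be an integer.\<close>

lemma bound_of_coprime_exponent:
  fixes x y z :: int and a b r s q m :: nat
  assumes "prime q" "\<bar>x\<bar> \<ge> 2" "r \<ge> 2" "s \<ge> 2"
    and y: "(of_int y :: real) ^ q = (of_int x ^ r - 1) / (of_int x - 1)"
    and z: "(of_int z :: real) ^ q = (of_int x ^ s - 1) / (of_int x - 1)"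
    and m: "q * m = a * (r - 1) + b * (s - 1)" "m > 0"
    and ab: "0 < a + b" "a + b < q"
  shows "\<bar>x\<bar> < 4 * int (q ^ bexp q m)"
proof -
  have q: "q > 0"
    using assms(1) by (rule prime_gt_0_nat)
  define \<alpha> \<beta> \<gamma> where "\<alpha> = real (a + b) / real q" and "\<beta> = real a / real q" and "\<gamma> = real b / real q"
  have exps: "0 \<le> \<alpha>" "\<alpha> \<le> 1" "0 \<le> \<beta>" "\<beta> \<le> 1" "0 \<le> \<gamma>" "\<gamma> \<le> 1"
    using ab by (auto simp: \<alpha>_def \<beta>_def \<gamma>_def)
  have rs: "r > 0" "s > 0"
    using assms(3,4) by auto
  define t where "t = 1 / real_of_int x"
  have t: "\<bar>t\<bar> < 1"
    unfolding t_def using assms(2) by (auto simp: divide_less_eq)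
  obtain w :: int where w: "of_int w = of_int x ^ m *
      ((1 - t) powr (-\<alpha>) * (1 - t ^ r) powr \<beta> * (1 - t ^ s) powr \<gamma>)"
    using power_product_eq[OF q assms(2) rs y z m(1)] unfolding \<alpha>_def \<beta>_def \<gamma>_def t_def by blast
  define A where "A = cprod (bc (-\<alpha>)) (sparse r (bc \<beta>))"
  define c where "c = rcoeff \<alpha> \<beta> \<gamma> r s"
  have \<alpha>: "-\<alpha> = of_int (- int (a + b)) / real q"
    by (simp add: \<alpha>_def add_divide_distrib diff_divide_distrib)
  have adm: "qadm q (bc (-\<alpha>))" "qadm q (bc \<beta>)" "qadm q (bc \<gamma>)"
    using qadm_bc[OF assms(1), of "- int (a + b)"] qadm_bc[OF assms(1), of "int a"]
      qadm_bc[OF assms(1), of "int b"]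
    unfolding \<alpha> by (simp_all add: \<beta>_def \<gamma>_def)
  have small: "qsmall q (sparse r (bc \<beta>))" "qsmall q (sparse s (bc \<gamma>))"
    using adm assms by (auto intro!: qsmall_sparse)
  have A: "qadm q A"
    unfolding A_def using adm small assms(1) by (intro qadm_cprod) auto
  have c_adm: "qadm q c"
    unfolding c_def rcoeff_def A_def[symmetric] using A small assms(1) by (intro qadm_cprod) auto
  \<comment> \<open>Both sparse factors change \<open>q ^ bexp q m * c m\<close> only by multiples
    of \<open>q\<close>, so it inherits indivisibility from \<open>bc (-\<alpha>) m\<close>.\<close>
  have lead: "real q ^ bexp q m * c m / real q \<notin> \<int>"
  proof
    assume "real q ^ bexp q m * c m / real q \<in> \<int>"
    moreover have "real q ^ bexp q m * (c m - A m) / real q \<in> \<int>"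
      unfolding c_def rcoeff_def A_def[symmetric] using A small assms(1) by (intro cprod_qsmall) auto
    moreover have "real q ^ bexp q m * (A m - bc (-\<alpha>) m) / real q \<in> \<int>"
      unfolding A_def using adm small assms(1) by (intro cprod_qsmall) auto
    ultimately have "real q ^ bexp q m * c m / real q - real q ^ bexp q m * (c m - A m) / real q
        - real q ^ bexp q m * (A m - bc (-\<alpha>) m) / real q \<in> \<int>"
      by (intro Ints_diff)
    then have "real q ^ bexp q m * bc (-\<alpha>) m / real q \<in> \<int>"
      by (simp add: diff_divide_distrib right_diff_distrib)
    moreover obtain u :: int where u: "real q ^ bexp q m * bc (-\<alpha>) m = of_int u"
      "\<not> int q dvd - int (a + b) \<Longrightarrow> \<not> int q dvd u"
      unfolding \<alpha> using bc_integrality[OF assms(1)] by blast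
    ultimately obtain v where "of_int u / real q = of_int v"
      by (metis Ints_cases)
    then have "of_int u = (of_int (int q * v) :: real)"
      using q by (simp add: field_simps)
    then have "int q dvd u"
      by (metis dvd_triv_left of_int_eq_iff)
    moreover have "\<not> int q dvd - int (a + b)"
      using ab by (metis dvd_minus_iff int_dvd_int_iff nat_dvd_not_less)
    ultimately show False
      using u(2) by blast
  qed
  have mexp: "m \<le> bexp q m"
    by (simp add: bexp_def)
  show ?thesis
  proof (rule runge_bound[where c = c, OF assms(2) _ _ _ _ w[unfolded t_def]])
    show "(\<lambda>n. c n * (1 / real_of_int x) ^ n) sums
        ((1 - 1 / real_of_int x) powr (-\<alpha>) * (1 - (1 / real_of_int x) ^ r) powr \<beta>
          * (1 - (1 / real_of_int x) ^ s) powr \<gamma>)"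
      using rcoeff_sums[OF exps rs t] unfolding c_def t_def .
    show "\<bar>c n\<bar> \<le> 2" for n
      unfolding c_def by (rule rcoeff_abs_le[OF exps rs])
    show "real (q ^ bexp q m) * c i \<in> \<int>" if "i \<le> m" for i
      using qadm_shift[OF c_adm bexp_mono[OF assms(1) that]] by simp
    show "of_int w \<noteq> (\<Sum>i\<le>m. c i * of_int x ^ (m - i))"
    proof
      assume eq: "of_int w = (\<Sum>i\<le>m. c i * of_int x ^ (m - i))"
      have "{..m} = insert m {..<m}"
        by auto
      then have "of_int w = c m + (\<Sum>i<m. c i * of_int x ^ (m - i))"
        using eq by simp
      then have "real q ^ bexp q m * c m / real q =
          real q ^ bexp q m / real q * of_int w
            - (\<Sum>i<m. real q ^ bexp q m * c i / real q * of_int x ^ (m - i))"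
        by (simp add: algebra_simps sum_distrib_left sum_divide_distrib add_divide_distrib)
      \<comment> \<open>\<open>m > 0\<close> gives \<open>bexp q m > 0\<close>, so this quotient is
        an integer.\<close>
      moreover have "real q ^ bexp q m / real q = real_of_int (int q ^ (bexp q m - 1))"
        using q m(2) mexp by (cases "bexp q m") auto
      moreover have "(\<Sum>i<m. real q ^ bexp q m * c i / real q * of_int x ^ (m - i)) \<in> \<int>"
      proof (rule Ints_sum)
        fix i assume "i \<in> {..<m}"
        then have "real q ^ bexp q m * c i / real q \<in> \<int>"
          by (intro qadm_shift_less[OF assms(1) c_adm] bexp_strict_mono[OF assms(1)]) auto
        then show "real q ^ bexp q m * c i / real q * of_int x ^ (m - i) \<in> \<int>"
          by (intro Ints_mult Ints_power) auto
      qed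
      ultimately have "real q ^ bexp q m * c m / real q \<in> \<int>"
        by (simp only:) (intro Ints_diff Ints_mult; simp)
      then show False
        using lead by blast
    qed
  qed (use q in auto)
qed

section \<open>The exceptional case \<open>a = q - 1\<close>\<close>

lemma bc_minus_1: "bc (-1) n = 1"
  by (induction n) (simp_all add: bc_Suc add.commute)

text \<open>Here \<open>a + b = q\<close>, so there is no \<open>q\<close>-adic obstruction to the vanishing of the integer;
  instead, its leading term is bounded away from zero by \<open>bc_neg_ge\<close>.\<close>

lemma bound_of_congruent_exponents:
  fixes x y z :: int and r k q :: nat
  assumes "prime q" "\<bar>x\<bar> \<ge> 2" "r \<ge> 2" "k > 0"
    and y: "(of_int y :: real) ^ q = (of_int x ^ r - 1) / (of_int x - 1)"
    and z: "(of_int z :: real) ^ q = (of_int x ^ (r + q * k) - 1) / (of_int x - 1)"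
    and large: "2 * int q * (int k + 1) + 1 < \<bar>x\<bar>"
  shows "\<bar>x\<bar> < 4 * int (q ^ bexp q k)"
proof -
  have q: "q > 1"
    using assms(1) by (rule prime_gt_1_nat)
  \<comment> \<open>This \<open>m\<close> solves the equation for \<open>q * m\<close> with
    \<open>a = q - 1\<close> and \<open>b = 1\<close>.\<close>
  define s m where "s = r + q * k" and "m = r - 1 + k"
  have m: "q * m = (q - 1) * (r - 1) + 1 * (s - 1)"
    using q assms(3) by (cases q; cases r) (auto simp: m_def s_def algebra_simps)
  define \<beta> \<gamma> where "\<beta> = real (q - 1) / real q" and "\<gamma> = real 1 / real q"
  have exps: "0 \<le> (1::real)" "(1::real) \<le> 1" "0 \<le> \<beta>" "\<beta> \<le> 1" "0 \<le> \<gamma>" "\<gamma> \<le> 1"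
    using q by (auto simp: \<beta>_def \<gamma>_def)
  have one: "real (q - 1 + 1) / real q = 1"
    using q by simp
  have rs: "r > 0" "s > 0"
    using assms(3) by (auto simp: s_def)
  have ms: "Suc m < s"
    using q assms(3,4) by (simp add: m_def s_def)
  define t where "t = 1 / real_of_int x"
  have t: "\<bar>t\<bar> < 1" "t \<noteq> 0"
    unfolding t_def using assms(2) by (auto simp add: divide_less_eq)
  define F where "F = (1 - t) powr (-1) * (1 - t ^ r) powr \<beta> * (1 - t ^ s) powr \<gamma>"
  have "q > 0"
    using q by simp
  then obtain w :: int where w: "of_int w = of_int x ^ m * F"
    using power_product_eq[OF _ assms(2) rs y z[folded s_def] m]
    unfolding one F_def \<beta>_def \<gamma>_def t_def by blast
  define c where "c = rcoeff 1 \<beta> \<gamma> r s"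
  \<comment> \<open>Below index \<open>s\<close> the factor in \<open>t ^ s\<close> contributes only
    its constant term. Partial sums then lower the exponent \<open>\<beta>\<close> to
    \<open>-1 / q\<close> and the index to \<open>i div r\<close>, which makes the denominators
    small.\<close>
  have c: "c i = bc (of_int (-1) / real q) (i div r)" if "i < s" for i
  proof -
    have \<beta>: "\<beta> - 1 = of_int (-1) / real q"
      using q by (simp add: \<beta>_def of_nat_diff field_simps)
    have "sparse s (bc \<gamma>) k = 0" if "k \<in> {1..i}" for k
      using that \<open>i < s\<close> by (auto simp: sparse_def dest: dvd_imp_le)
    then have "c i = cprod (bc (-1)) (sparse r (bc \<beta>)) i"
      unfolding c_def rcoeff_def by (subst cprod_split) auto
    also have "\<dots> = (\<Sum>k\<le>i. sparse r (bc \<beta>) k)"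
      by (simp add: cprod_split sum_split_first bc_minus_1)
    also have "\<dots> = bc (\<beta> - 1) (i div r)"
      unfolding sum_sparse[OF rs(1)] sum_bc ..
    finally show ?thesis
      unfolding \<beta> .
  qed
  have sums: "(\<lambda>n. c n * t ^ n) sums F"
    unfolding c_def F_def by (rule rcoeff_sums[OF exps rs t(1)])
  have bound: "\<bar>c n\<bar> \<le> 2" for n
    unfolding c_def by (rule rcoeff_abs_le[OF exps rs])
  show ?thesis
  proof (rule runge_bound[where c = c, OF assms(2) _ sums[unfolded t_def] bound _ w])
    show "real (q ^ bexp q k) * c i \<in> \<int>" if "i \<le> m" for i
    proof -
      \<comment> \<open>Since \<open>m = k + (r - 1)\<close>, this crude bound yields
        \<open>i div r \<le> k\<close>, so that \<open>k\<close> replaces \<open>m\<close> in the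
        denominator.\<close>
      have "i \<le> r * k + (r - 1)"
        using that mult_le_mono1[of 1 r k] rs(1) unfolding m_def by linarith
      then have "i div r \<le> (r * k + (r - 1)) div r"
        by (rule div_le_mono)
      also have "\<dots> = k"
        using rs(1) by (subst div_mult_self4) auto
      finally have "real q ^ bexp q k * bc (of_int (-1) / real q) (i div r) \<in> \<int>"
        by (intro qadm_shift[OF qadm_bc[OF assms(1)]] bexp_mono[OF assms(1)])
      then show ?thesis
        using c[of i] that ms by simp
    qed
    show "of_int w \<noteq> (\<Sum>i\<le>m. c i * of_int x ^ (m - i))"
    proof
      assume eq: "of_int w = (\<Sum>i\<le>m. c i * of_int x ^ (m - i))"
      define X where "X = real_of_int x"
      have X: "\<bar>X\<bar> > 1" "X \<noteq> 0" and tX: "t = 1 / X"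
        using assms(2) by (auto simp: X_def t_def)
      have "X ^ m * F = X ^ m * (\<Sum>i<Suc m. c i * t ^ i)"
        using eq unfolding w X_def[symmetric] lessThan_Suc_atMost sum_distrib_left
        using X by (auto intro!: sum.cong simp: tX power_diff power_divide)
      then have "F = (\<Sum>i<Suc m. c i * t ^ i)"
        using X by simp
      \<comment> \<open>If the difference vanishes, the term of index \<open>Suc m\<close> cancels
        against all later ones and is bounded by their tail.\<close>
      then have "\<bar>c (Suc m) * t ^ Suc m\<bar> \<le> 2 * \<bar>t\<bar> ^ Suc (Suc m) / (1 - \<bar>t\<bar>)"
        using power_series_tail_bound[OF sums bound t(1), of "Suc (Suc m)"] by simp
      then have "\<bar>t\<bar> ^ Suc m * \<bar>c (Suc m)\<bar> \<le> \<bar>t\<bar> ^ Suc m * (2 * \<bar>t\<bar> / (1 - \<bar>t\<bar>))"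
        by (simp add: abs_mult power_abs mult_ac)
      then have "c (Suc m) \<le> 2 * \<bar>t\<bar> / (1 - \<bar>t\<bar>)"
        using t by (subst (asm) mult_le_cancel_left_pos) auto
      also have "2 * \<bar>t\<bar> / (1 - \<bar>t\<bar>) = 2 / (\<bar>X\<bar> - 1)"
        using X by (simp add: tX field_simps)
      finally have up: "c (Suc m) \<le> 2 / (\<bar>X\<bar> - 1)" .
      have "Suc m div r = Suc (k div r)"
        using rs(1) by (simp add: m_def)
      then have "(1 / real q) / (real (k div r) + 1) \<le> c (Suc m)"
        using bc_neg_ge[of "1 / real q" "k div r"] c[OF ms] by simp
      moreover have "(1 / real q) / (real k + 1) \<le> (1 / real q) / (real (k div r) + 1)"
        by (intro divide_left_mono) auto
      ultimately have "(1 / real q) / (real k + 1) \<le> 2 / (\<bar>X\<bar> - 1)"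
        using up by linarith
      then have le: "1 / (real q * (real k + 1)) \<le> 2 / (\<bar>X\<bar> - 1)"
        by simp
      have "Y \<le> 2 * P" if "1 / P \<le> 2 / Y" "P > 0" "Y > 0" for P Y :: real
        using that by (simp add: field_simps)
      from this[OF le] have "\<bar>X\<bar> - 1 \<le> 2 * real q * (real k + 1)"
        using X(1) q by (simp add: mult.assoc)
      moreover have "real_of_int (2 * int q * (int k + 1) + 1) < real_of_int \<bar>x\<bar>"
        using large by (simp only: of_int_less_iff)
      then have "2 * real q * (real k + 1) + 1 < \<bar>X\<bar>"
        by (simp add: X_def)
      ultimately show False
        by linarith
    qed
  qed (use q in auto)
qed

section \<open>Choice of the exponents and comparison with the claimed bound\<close>

theorem theorem2:
  fixes q r s :: nat and x y z :: int
  assumes "prime q"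
    and "3 \<le> r" and "r < s"
    and "x \<noteq> 1"
    and "(of_int y :: real) ^ q = (of_int x ^ r - 1) / (of_int x - 1)"
    and "(of_int z :: real) ^ q = (of_int x ^ s - 1) / (of_int x - 1)"
  shows "(of_int \<bar>x\<bar> :: real)
    < 4 * max 1 (real s / (real q * real r))
        * real q powr (real r - 1 + (real s - real r) / (real q - 1))"
proof -
  have q: "q > 1"
    using assms(1) by (rule prime_gt_1_nat)
  define E where "E = real r - 1 + (real s - real r) / (real q - 1)"
  have E0: "E \<ge> 0"
    using assms(2,3) q unfolding E_def by (intro add_nonneg_nonneg divide_nonneg_nonneg) auto
  \<comment> \<open>Bounding the maximum below by \<open>1\<close> reduces every case to an exponent
    at most \<open>E\<close>.\<close>
  have red: ?thesis if "of_int \<bar>x\<bar> < 4 * real q powr E"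
  proof -
    have "1 * (4 * real q powr E) \<le> max 1 (real s / (real q * real r)) * (4 * real q powr E)"
      by (intro mult_right_mono) auto
    then show ?thesis
      using that unfolding E_def by (simp add: mult_ac)
  qed
  have red': ?thesis if "\<bar>x\<bar> < 4 * int (q ^ e)" "real e \<le> E" for e
  proof (rule red)
    have "real_of_int \<bar>x\<bar> < real_of_int (4 * int (q ^ e))"
      using that(1) by (simp only: of_int_less_iff)
    also have "\<dots> = 4 * real q powr real e"
      using q by (simp add: powr_realpow)
    also have "\<dots> \<le> 4 * real q powr E"
      using that(2) q by (simp add: powr_mono)
    finally show "of_int \<bar>x\<bar> < 4 * real q powr E" .
  qed
  have q1: "real q - 1 > 0"
    using q by simp
  \<comment> \<open>By Legendre's bound it suffices to compare \<open>q * m\<close> with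
    \<open>(q - 1) * E\<close>, which is linear in \<open>r\<close> and in \<open>s\<close>.\<close>
  have bexp: "real (bexp q m) \<le> E" if "real q * real m \<le> (real q - 1) * E" for m
  proof -
    have "real q * real m / (real q - 1) \<le> E"
      using that q1 by (simp add: divide_le_eq mult.commute)
    with bexp_le[OF assms(1), of m] show ?thesis
      by linarith
  qed
  have E: "(real q - 1) * E = (real q - 1) * (real r - 1) + (real s - real r)"
    using q1 by (simp add: E_def field_simps)
  show ?thesis
  proof (cases "\<bar>x\<bar> \<ge> 2")
    case False
    then show ?thesis
      using E0 by (intro red'[of 0]) auto
  next
    case x: True
    show ?thesis
    proof (cases "q dvd r - 1")
      case True
      then obtain m where m: "r - 1 = q * m"
        by (elim dvdE)
      have "real q * real m = real r - 1"
        using m assms(2) by (metis of_nat_1 of_nat_diff of_nat_mult le_trans one_le_numeral)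
      also have "\<dots> \<le> (real q - 1) * (real r - 1)"
        using q assms(2) by (intro mult_le_cancel_right1[THEN iffD2]) auto
      also have "\<dots> \<le> (real q - 1) * E"
        unfolding E using assms(3) by simp
      finally have "real (bexp q m) \<le> E"
        by (rule bexp)
      moreover have "m > 0"
        using m assms(2) by (cases m) auto
      ultimately show ?thesis
        using bound_of_coprime_exponent[OF assms(1) x _ _ assms(5,6), of m 1 0] red' assms(2,3) m q by simp
    next
      case False
      have "coprime q (r - 1)"
        using assms(1) False by (simp add: prime_imp_coprime)
      then obtain a0 where "[(r - 1) * a0 = 1] (mod q)"
        using cong_solve_coprime_nat[of "r - 1" q] by (auto simp: coprime_commute)
      \<comment> \<open>Solves \<open>a * (r - 1) + (s - 1) = 0\<close> modulo \<open>q\<close>; the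
        factor \<open>q - 1\<close> stands for \<open>-1\<close> within the naturals.\<close>
      define a where "a = (q - 1) * (s - 1) * a0 mod q"
      have a: "a < q"
        using q by (simp add: a_def)
      have "[a = (q - 1) * (s - 1) * a0] (mod q)"
        by (simp add: a_def)
      then have "[a * (r - 1) + 1 * (s - 1) = (q - 1) * (s - 1) * a0 * (r - 1) + 1 * (s - 1)] (mod q)"
        by (intro cong_add cong_mult cong_refl)
      also have "(q - 1) * (s - 1) * a0 * (r - 1) + 1 * (s - 1)
          = (q - 1) * (s - 1) * ((r - 1) * a0) + (s - 1)"
        by (simp add: mult_ac)
      also have "[(q - 1) * (s - 1) * ((r - 1) * a0) + (s - 1) = (q - 1) * (s - 1) * 1 + (s - 1)] (mod q)"
        using \<open>[(r - 1) * a0 = 1] (mod q)\<close> by (intro cong_add cong_mult) auto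
      also have "(q - 1) * (s - 1) * 1 + (s - 1) = q * (s - 1)"
        using q by (cases q) auto
      finally have "q dvd a * (r - 1) + 1 * (s - 1)"
        using cong_dvd_iff by (metis cong_sym cong_dvd_iff dvd_triv_left)
      then obtain m where m: "q * m = a * (r - 1) + 1 * (s - 1)"
        by (metis dvdE)
      show ?thesis
      proof (cases "a = q - 1")
        case False
        then have aq: "a \<le> q - 2"
          using a by simp
        have "real q * real m = real a * (real r - 1) + (real s - 1)"
          using arg_cong[OF m, of real] assms(2,3) by (simp add: of_nat_diff)
        \<comment> \<open>For \<open>a = q - 2\<close> the bound is attained: the right-hand side is
          exactly \<open>(q - 1) * E\<close>.\<close>
        also have "\<dots> \<le> (real q - 2) * (real r - 1) + (real s - 1)"
          using aq q assms(2) by (intro add_right_mono mult_right_mono) auto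
        also have "\<dots> = (real q - 1) * E"
          unfolding E by (simp add: algebra_simps)
        finally have "real (bexp q m) \<le> E"
          by (rule bexp)
        moreover have "m > 0"
          using m assms(2,3) by (cases m) auto
        moreover have "a + 1 < q"
          using aq a False by simp
        ultimately show ?thesis
          using bound_of_coprime_exponent[OF assms(1) x _ _ assms(5,6) m] red' assms(2,3) by simp
      next
        case True
        have "q * m + (r - 1) = q * (r - 1) + (s - 1)"
          using m True q by (cases q) auto
        then have "q * m = q * (r - 1) + (s - r)"
          using assms(2,3) by simp
        then have "q dvd s - r"
          by (metis dvd_add_right_iff dvd_triv_left)
        then obtain k where k: "s - r = q * k"
          by (elim dvdE)
        have s: "s = r + q * k" "k > 0"
          using k assms(3) by (auto intro: Nat.gr0I)
        \<comment> \<open>\<open>r \<ge> 3\<close> provides the slack \<open>2 * (q - 1)\<close>,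
          which allows the exponent \<open>k + 2\<close> for small
          \<open>\<bar>x\<bar>\<close>.\<close>
        have kE: "real q * real k + 2 * (real q - 1) \<le> (real q - 1) * E"
        proof -
          have "(real q - 1) * 2 \<le> (real q - 1) * (real r - 1)"
            using q1 assms(2) by (intro mult_left_mono) auto
          then show ?thesis
            unfolding E using s(1) by simp
        qed
        have kE': "real (k + 2) \<le> E"
        proof -
          have "(real q - 1) * real (k + 2) \<le> (real q - 1) * E"
            using kE by (simp add: algebra_simps)
          then show ?thesis
            using q1 by (simp only: mult_le_cancel_left_pos)
        qed
        show ?thesis
        proof (cases "2 * int q * (int k + 1) + 1 < \<bar>x\<bar>")
          case True
          have "real (bexp q k) \<le> E"
            by (intro bexp order_trans[OF _ kE]) (use q1 in simp)
          then show ?thesis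
            using bound_of_congruent_exponents[OF assms(1) x _ s(2) assms(5) assms(6)[unfolded s(1)] True] red' assms(2) by simp
        next
          case False
          \<comment> \<open>For \<open>\<bar>x\<bar>\<close> too small for the lemma,
            \<open>k + 1 \<le> q ^ k\<close> bounds it directly by
            \<open>4 * q ^ (k + 2)\<close>.\<close>
          have "int k + 1 \<le> int (2 ^ k)"
            using of_nat_less_two_power[of k] less_exp[of k] by linarith
          also have "int (2 ^ k) \<le> int (q ^ k)"
            using q by (simp only: of_nat_le_iff) (intro power_mono; simp)
          finally have k1: "int k + 1 \<le> int q ^ k"
            by simp
          have "2 * int q * (int k + 1) + 1 < 4 * int q * (int k + 1)"
          proof -
            have "int q * (int k + 1) \<ge> 1 * 1"
              using q by (intro mult_mono) auto
            then show ?thesis by linarith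
          qed
          also have "\<dots> \<le> 4 * int q * (int q * int q ^ k)"
            using k1 q by (intro mult_left_mono) (auto intro: order_trans[OF k1] simp: mult_le_cancel_right1)
          also have "\<dots> = 4 * int (q ^ (k + 2))"
            by simp
          finally show ?thesis
            using False kE' by (intro red'[of "k + 2"]) linarith+
        qed
      qed
    qed
  qed
qed

end
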